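(* Let $\mathcal{G}=(\mathcal{V},\mathcal{E},\mathcal{A})$ be a weighted directed graph with $n$ nodes that is strongly connected, let $L=(l_{ij})$ be its graph Laplacian, and let $\xi=(\xi_1,\dots,\xi_n)^T$ be the left eigenvector of $L$ for the eigenvalue $0$ normalized by $\sum_{i=1}^n\xi_i=1$. Let $h:\mathbb{R}\to\mathbb{R}$ be a strictly increasing function. Then the nonlinear protocol $$\dot{x}_i(t)=-\sum_{j=1}^{n}l_{ij}\,h(x_j(t)),\qquad i=1,\dots,n,$$ realizes consensus globally for all initial states, with group decision $x_\xi=\sum_{i=1}^n\xi_i x_i(0)$. That is, for every initial state $x(0)\in\mathbb{R}^n$ and every solution $x(t)=(x_1(t),\dots,x_n(t))^T$, $t\ge 0$, of this system starting from $x(0)$, $$\lim_{t\to\infty}x_i(t)=\sum_{k=1}^n\xi_k x_k(0)\qquad\text{for all } i=1,\dots,n.$$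
   Context: A weighted directed graph $\mathcal{G}=(\mathcal{V},\mathcal{E},\mathcal{A})$ consists of a node set $\mathcal{V}=\{v_1,\dots,v_n\}$, an edge set $\mathcal{E}\subseteq\mathcal{V}\times\mathcal{V}$ without self-loops, and a weighted adjacency matrix $\mathcal{A}=(a_{ij})$ with real entries $a_{ij}\ge 0$, $a_{ii}=0$, and $a_{ij}>0$ if and only if $(v_i,v_j)\in\mathcal{E}$ (meaning that $v_i$ receives information from $v_j$). The weights need not be symmetric. The graph Laplacian $L=(l_{ij})$ is defined by $l_{ii}=\sum_{k\neq i}a_{ik}$ and $l_{ij}=-a_{ij}$ for $i\neq j$. A path from $v_{i_0}$ to $v_{i_m}$ is an ordered set of distinct vertices $\{v_{i_0},\dots,v_{i_m}\}$ with $(v_{i_{j-1}},v_{i_j})\in\mathcal{E}$ for $j=1,\dots,m$. The graph is strongly connected if a path exists from every vertex to every vertex. For a strongly connected digraph, the eigenvalue $0$ of $L$ has multiplicity one, and there is a unique vector $\xi=(\xi_1,\dots,\xi_n)^T$ with $\xi^T L=0$ and $\sum_{i=1}^n\xi_i=1$; it satisfies $\xi_i>0$ for all $i$. Each $x_i(t)\in\mathbb{R}$ is the value of node $v_i$ at time $t$. Consensus means convergence to the one-dimensional agreement space $x_1=x_2=\cdots=x_n$, i.e. $x=\beta\,(1,\dots,1)^T$ with $\beta\in\mathbb{R}$; the number $\beta$ is called the group decision. *)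

theory Defs
  imports
    "HOL-Analysis.Analysis"
    "Graph_Theory.Digraph_Component"
    "Graph_Theory.Pair_Digraph"
begin

text \<open>
  The nodes \<open>v\<^sub>1, \<dots>, v\<^sub>n\<close> are the elements of the finite index type \<open>'n\<close>, so that
  \<open>n = CARD('n)\<close>. An arc \<open>(i, j)\<close> means that node \<open>i\<close> receives information from node \<open>j\<close>;
  \<open>pair_digraph\<close> excludes self-loops.
\<close>

locale weighted_digraph = pair_digraph G for G :: "'n::finite pair_pre_digraph" +
  fixes A :: "real ^ 'n ^ 'n"
  assumes verts_UNIV: "pverts G = UNIV"
    and weight_nonneg: "A $ i $ j \<ge> 0"
    and weight_diag: "A $ i $ i = 0"
    and weight_pos_iff: "A $ i $ j > 0 \<longleftrightarrow> (i, j) \<in> parcs G"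

definition graph_laplacian :: "real ^ 'n ^ 'n \<Rightarrow> real ^ 'n::finite ^ 'n" where
  "graph_laplacian A =
     (\<chi> i j. if i = j then (\<Sum>k\<in>UNIV - {i}. A $ i $ k) else - (A $ i $ j))"

text \<open>
  Classical solutions on \<open>[0, \<infinity>)\<close>: the equation holds at every \<open>t \<ge> 0\<close>, with the one-sided
  derivative at \<open>t = 0\<close>. The values of \<open>x\<close> at negative times are irrelevant.
\<close>

definition protocol_solution ::
    "real ^ 'n ^ 'n \<Rightarrow> (real \<Rightarrow> real) \<Rightarrow> (real \<Rightarrow> real ^ 'n::finite) \<Rightarrow> bool" where
  "protocol_solution L h x \<longleftrightarrow>
     (\<forall>t\<ge>0. \<forall>i. ((\<lambda>s. x s $ i) has_real_derivative
        - (\<Sum>j\<in>UNIV. L $ i $ j * h (x t $ j))) (at t within {0..}))"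

end

theory Submission
  imports Defs
begin

text \<open>
  As \<open>h\<close> need not be continuous, energy functions along a trajectory are only one-sidedly
  controlled: a continuous function that is touched from below, on the left of every point, by a
  differentiable function of slope at most \<open>c\<close> grows at rate at most \<open>c\<close>. Applied to
  \<open>max\<^sub>i x\<^sub>i\<close> and \<open>max\<^sub>i (- x\<^sub>i)\<close>, this shows that the smallest interval containing all the
  states shrinks. Applied to \<open>V = \<Sum>\<^sub>i \<xi>\<^sub>i H(x\<^sub>i)\<close>, where \<open>H\<close> is a convex function with
  subgradient \<open>h\<close>, it shows that \<open>V\<close> decreases at least at the rate
  \<open>(1/2) \<Sum>\<^sub>i\<^sub>j \<xi>\<^sub>i a\<^sub>i\<^sub>j (h(x\<^sub>j) - h(x\<^sub>i))\<^sup>2\<close>. By strong connectivity and positivity of \<open>\<xi>\<close> this rate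
  is bounded below as long as the states are spread out, whereas \<open>V\<close> is bounded below because
  \<open>\<Sum>\<^sub>i \<xi>\<^sub>i x\<^sub>i\<close> is conserved. So the spread tends to \<open>0\<close>, and the conserved mean is the limit.
\<close>

subsection \<open>Growth of functions supported from below\<close>

text \<open>For each slope \<open>c + e\<close> with \<open>e > 0\<close>, take the least point
  \<open>m\<close> from which the bound up to \<open>b\<close> holds. If \<open>m > a\<close>, a
  support at \<open>m\<close> of slope below \<open>c + e\<close> extends the bound to points left
  of \<open>m\<close>, a contradiction.\<close>

lemma growth_le_of_left_support:
  fixes F :: "real \<Rightarrow> real"
  assumes "a \<le> b" and cont: "continuous_on {a..b} F"
    and support: "\<And>t. a < t \<Longrightarrow> t \<le> b \<Longrightarrow>
      \<exists>u D. (u has_real_derivative D) (at t within {a..b}) \<and> D \<le> c \<and> u t = F t \<and>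
        (\<forall>s\<in>{a..t}. u s \<le> F s)"
  shows "F b - F a \<le> c * (b - a)"
proof -
  have *: "F b - F a \<le> (c + e) * (b - a)" if "e > 0" for e
  proof -
    define S where "S = {a..b} \<inter> (\<lambda>s. F b - F s - (c + e) * (b - s)) -` {..0}"
    have "closed S"
      unfolding S_def using cont
      by (intro continuous_closed_preimage continuous_intros) auto
    then have "compact S"
      by (auto simp: compact_eq_bounded_closed S_def intro: bounded_subset[OF bounded_closed_interval])
    moreover have "b \<in> S" using \<open>a \<le> b\<close> by (simp add: S_def)
    ultimately obtain m where m: "m \<in> S" "\<And>s. s \<in> S \<Longrightarrow> m \<le> s"
      using compact_attains_inf[of S] by blast
    have "m = a"
    proof (rule ccontr)
      assume "m \<noteq> a"
      with m have "a < m" "m \<le> b" by (auto simp: S_def)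
      then obtain u D where u: "(u has_real_derivative D) (at m within {a..b})" "D \<le> c"
          "u m = F m" "\<And>s. s \<in> {a..m} \<Longrightarrow> u s \<le> F s"
        using support by blast
      have "((\<lambda>s. u s - (c + e) * s) has_real_derivative D - (c + e)) (at m within {a..b})"
        by (auto intro!: derivative_eq_intros u)
      from has_real_derivative_neg_dec_left[OF this] obtain d where d: "d > 0"
          "\<And>r. r > 0 \<Longrightarrow> m - r \<in> {a..b} \<Longrightarrow> r < d \<Longrightarrow>
            u m - (c + e) * m < u (m - r) - (c + e) * (m - r)"
        using \<open>D \<le> c\<close> \<open>e > 0\<close> by auto
      define r where "r = min (d / 2) (m - a)"
      have r: "r > 0" "r < d" "m - r \<in> {a..b}" "m - r \<in> {a..m}"
        using d(1) \<open>a < m\<close> \<open>m \<le> b\<close> by (auto simp: r_def)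
      have "F b - F m - (c + e) * (b - m) \<le> 0" using m by (simp add: S_def)
      with d(2)[OF r(1,3,2)] u(3) u(4)[OF r(4)]
      have "m - r \<in> S" using r(3) by (simp add: S_def algebra_simps)
      with m(2) r(1) show False by fastforce
    qed
    with m(1) show ?thesis by (simp add: S_def)
  qed
  show ?thesis
  proof (rule field_le_epsilon)
    fix d :: real assume "d > 0"
    \<comment> \<open>The \<open>+ 1\<close> keeps the denominator positive when
      \<open>a = b\<close>.\<close>
    define e where "e = d / (b - a + 1)"
    have "e > 0" "e * (b - a) \<le> d"
      using \<open>d > 0\<close> \<open>a \<le> b\<close> by (auto simp: e_def field_simps)
    with *[of e] show "F b - F a \<le> c * (b - a) + d" by (simp add: algebra_simps)
  qed
qed

lemma continuous_on_Max_image: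
  fixes f :: "'i \<Rightarrow> 'a::topological_space \<Rightarrow> 'b::linorder_topology"
  assumes "finite I" "I \<noteq> {}" "\<And>i. i \<in> I \<Longrightarrow> continuous_on S (f i)"
  shows "continuous_on S (\<lambda>s. Max ((\<lambda>i. f i s) ` I))"
  using assms by (induction I rule: finite_ne_induct) (auto intro!: continuous_on_max)

subsection \<open>Monotone functions\<close>

text \<open>\<open>H\<close> is a primitive of \<open>h\<close>: monotone functions are integrable,
  continuous or not, and the integral over \<open>{x..y}\<close> lies between the end values of
  \<open>h\<close> times the length.\<close>

lemma mono_is_subgradient:
  fixes h :: "real \<Rightarrow> real"
  assumes "mono h"
  obtains H where "\<And>x y. h x * (y - x) \<le> H y - H x"
proof -
  have int: "h integrable_on {x..y}" for x y
    by (rule integrable_on_mono_on) (use assms in \<open>auto simp: mono_on_def mono_def\<close>)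
  define H where "H y = (if y \<ge> 0 then integral {0..y} h else - integral {y..0} h)" for y
  have H: "H y - H x = integral {x..y} h" if "x \<le> y" for x y
    using that
      Henstock_Kurzweil_Integration.integral_combine[of 0 x y h, OF _ _ int]
      Henstock_Kurzweil_Integration.integral_combine[of x 0 y h, OF _ _ int]
      Henstock_Kurzweil_Integration.integral_combine[of x y 0 h, OF _ _ int]
    by (auto simp: H_def)
  have "h x * (y - x) \<le> integral {x..y} h" "integral {x..y} h \<le> h y * (y - x)" if "x \<le> y" for x y
    using integral_le[OF integrable_const_ivl int, of x y "h x"]
      integral_le[OF int integrable_const_ivl, of x y "h y"] that assms
    by (auto simp: mono_def mult.commute)
  then have "h x * (y - x) \<le> H y - H x" for x y
    using H[of x y] H[of y x] by (cases "x \<le> y") (force simp: algebra_simps)+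
  then show thesis by (rule that)
qed

text \<open>Averaging the subgradient inequalities at the convex combination \<open>z\<close>
  cancels the linear terms. Convexity later supplies the continuity of \<open>H\<close>.\<close>

lemma convex_on_if_subgradient:
  fixes H h :: "real \<Rightarrow> real"
  assumes "\<And>x y. h x * (y - x) \<le> H y - H x"
  shows "convex_on UNIV H"
proof (rule convex_onI)
  fix t x y :: real
  assume t: "0 < t" "t < 1"
  define z where "z = (1 - t) * x + t * y"
  have "(1 - t) * (h z * (x - z)) + t * (h z * (y - z))
      \<le> (1 - t) * (H x - H z) + t * (H y - H z)"
    using assms t by (intro add_mono mult_left_mono) auto
  moreover have "(1 - t) * (h z * (x - z)) + t * (h z * (y - z)) = 0"
    by (simp add: z_def algebra_simps)
  ultimately show "H ((1 - t) *\<^sub>R x + t *\<^sub>R y) \<le> (1 - t) * H x + t * H y"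
    by (simp add: z_def algebra_simps)
qed auto

text \<open>Cut the line into cells of length \<open>\<epsilon> / 2\<close>. The interval from
  \<open>x\<close> to \<open>y\<close> contains a whole cell, and for \<open>x\<close> between
  \<open>p\<close> and \<open>q\<close> only finitely many cells arise, each with a positive
  increment of \<open>h\<close>.\<close>

lemma strict_mono_uniform_increase:
  fixes h :: "real \<Rightarrow> real"
  assumes h: "strict_mono h" and "\<epsilon> > 0"
  obtains c where "c > 0"
    "\<And>x y. p \<le> x \<Longrightarrow> x \<le> q \<Longrightarrow> x + \<epsilon> \<le> y \<Longrightarrow> c \<le> h y - h x"
proof (cases "p \<le> q")
  case True
  define d where "d = \<epsilon> / 2"
  have "d > 0" using assms by (simp add: d_def)
  define C where "C = (\<lambda>k::int. h ((k + 1) * d) - h (k * d)) ` {\<lceil>p / d\<rceil>..\<lceil>q / d\<rceil>}"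
  have C: "finite C" "C \<noteq> {}"
    using True \<open>d > 0\<close> by (auto simp: C_def intro!: ceiling_mono divide_right_mono)
  have "Min C > 0"
    using C \<open>d > 0\<close> by (auto simp: C_def intro!: strict_monoD[OF h])
  moreover have "Min C \<le> h y - h x" if "p \<le> x" "x \<le> q" "x + \<epsilon> \<le> y" for x y
  proof -
    \<comment> \<open>\<open>k * d\<close> is the first grid point not left of \<open>x\<close>. It
      lies within \<open>d\<close> of \<open>x\<close>, so the next grid point is at most
      \<open>x + 2 * d = x + \<epsilon>\<close>.\<close>
    define k where "k = \<lceil>x / d\<rceil>"
    have "x / d \<le> k" "k \<le> x / d + 1" unfolding k_def by linarith+
    then have k: "x \<le> k * d" "(k + 1) * d \<le> y"
      using \<open>d > 0\<close> that by (auto simp: d_def field_simps)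
    have "k \<in> {\<lceil>p / d\<rceil>..\<lceil>q / d\<rceil>}"
      unfolding k_def using that \<open>d > 0\<close> by (auto intro!: ceiling_mono divide_right_mono)
    then have "h ((k + 1) * d) - h (k * d) \<in> C"
      unfolding C_def by (rule rev_image_eqI) simp
    with C(1) have "Min C \<le> h ((k + 1) * d) - h (k * d)" by (rule Min_le)
    also have "\<dots> \<le> h y - h x"
      using k strict_mono_mono[OF h] by (intro diff_mono) (auto simp: mono_def)
    finally show ?thesis .
  qed
  ultimately show thesis by (rule that)
qed (use that[of 1] in auto)

subsection \<open>Laplacians\<close>

lemma graph_laplacian_apply:
  "(\<Sum>j\<in>UNIV. graph_laplacian A $ i $ j * y j) = (\<Sum>j\<in>UNIV. A $ i $ j * (y i - y j))"
proof -
  have "(\<Sum>j\<in>UNIV. graph_laplacian A $ i $ j * y j)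
      = (\<Sum>k\<in>UNIV - {i}. A $ i $ k) * y i + (\<Sum>j\<in>UNIV - {i}. - (A $ i $ j) * y j)"
    by (subst sum.remove[of _ i]) (auto simp: graph_laplacian_def intro!: sum.cong)
  also have "\<dots> = (\<Sum>j\<in>UNIV - {i}. A $ i $ j * (y i - y j))"
    by (simp add: sum_distrib_right sum.distrib[symmetric] right_diff_distrib)
  also have "\<dots> = (\<Sum>j\<in>UNIV. A $ i $ j * (y i - y j))"
    by (subst (2) sum.remove[of _ i]) auto
  finally show ?thesis .
qed

text \<open>A balance condition: for the rescaled weights \<open>w $ i * A $ i $ j\<close>, column
  and row sums agree at every node.\<close>

lemma graph_laplacian_left_null_iff:
  "w v* graph_laplacian A = 0 \<longleftrightarrow>
    (\<forall>j. (\<Sum>i\<in>UNIV. w $ i * A $ i $ j) = w $ j * (\<Sum>k\<in>UNIV. A $ j $ k))"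
proof -
  have "(w v* graph_laplacian A) $ j
      = w $ j * (\<Sum>k\<in>UNIV. A $ j $ k) - (\<Sum>i\<in>UNIV. w $ i * A $ i $ j)" for j
  proof -
    have "(w v* graph_laplacian A) $ j
        = w $ j * (\<Sum>k\<in>UNIV - {j}. A $ j $ k) + (\<Sum>i\<in>UNIV - {j}. - (w $ i * A $ i $ j))"
      unfolding vector_matrix_mult_def vec_lambda_beta
      by (subst sum.remove[of _ j])
        (auto simp: graph_laplacian_def mult.commute intro!: sum.cong)
    also have "\<dots> = w $ j * (\<Sum>k\<in>UNIV. A $ j $ k) - (\<Sum>i\<in>UNIV. w $ i * A $ i $ j)"
      by (simp add: sum.remove[of UNIV j] sum_negf algebra_simps)
    finally show ?thesis .
  qed
  then show ?thesis by (auto simp: vec_eq_iff)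
qed

text \<open>Swapping the sums and applying the balance condition makes the \<open>y j\<close> and
  \<open>y i\<close> parts equal. It serves both for the conserved mean and, with squares, for the
  energy identity.\<close>

lemma graph_laplacian_conserved:
  assumes "w v* graph_laplacian A = 0"
  shows "(\<Sum>i\<in>UNIV. w $ i * (\<Sum>j\<in>UNIV. A $ i $ j * (y j - y i))) = 0"
proof -
  have "(\<Sum>i\<in>UNIV. w $ i * (\<Sum>j\<in>UNIV. A $ i $ j * y j))
      = (\<Sum>j\<in>UNIV. (\<Sum>i\<in>UNIV. w $ i * A $ i $ j) * y j)"
    unfolding sum_distrib_left sum_distrib_right by (subst sum.swap) (simp add: mult.assoc)
  also have "\<dots> = (\<Sum>j\<in>UNIV. w $ j * (\<Sum>k\<in>UNIV. A $ j $ k * y j))"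
    using assms by (simp add: graph_laplacian_left_null_iff sum_distrib_right mult.assoc)
  finally show ?thesis by (simp add: right_diff_distrib sum_subtractf)
qed

text \<open>Split \<open>y i * (y j - y i)\<close> into half the difference of squares minus half
  the squared difference; the former sums to zero by
  \<open>graph_laplacian_conserved\<close>.\<close>

lemma graph_laplacian_energy:
  assumes "w v* graph_laplacian A = 0"
  shows "(\<Sum>i\<in>UNIV. w $ i * y i * (\<Sum>j\<in>UNIV. A $ i $ j * (y j - y i)))
    = - (\<Sum>i\<in>UNIV. \<Sum>j\<in>UNIV. w $ i * A $ i $ j * (y j - y i)\<^sup>2) / 2"
proof -
  have "w $ i * y i * (A $ i $ j * (y j - y i))
      = w $ i * (A $ i $ j * ((y j)\<^sup>2 - (y i)\<^sup>2)) / 2 - w $ i * A $ i $ j * (y j - y i)\<^sup>2 / 2" for i j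
    by (simp add: power2_eq_square field_simps)
  then have "(\<Sum>i\<in>UNIV. w $ i * y i * (\<Sum>j\<in>UNIV. A $ i $ j * (y j - y i)))
      = (\<Sum>i\<in>UNIV. w $ i * (\<Sum>j\<in>UNIV. A $ i $ j * ((y j)\<^sup>2 - (y i)\<^sup>2))) / 2
        - (\<Sum>i\<in>UNIV. \<Sum>j\<in>UNIV. w $ i * A $ i $ j * (y j - y i)\<^sup>2) / 2"
    unfolding sum_distrib_left sum_divide_distrib by (simp add: sum_subtractf)
  then show ?thesis using graph_laplacian_conserved[OF assms, of "\<lambda>i. (y i)\<^sup>2"] by simp
qed

section \<open>Irreducible weights: positivity of the left null vector and a Poincare
  inequality\<close>

locale irreducible_weights =
  fixes A :: "real ^ 'n ^ 'n::finite"
  assumes weight_nonneg: "A $ i $ j \<ge> 0"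
    and connected: "(i, j) \<in> {(i, j). A $ i $ j > 0}\<^sup>*"
begin

text \<open>Positivity spreads along edges: a positive \<open>w $ i\<close> and an edge to
  \<open>j\<close> make the column sum at \<open>j\<close> positive, and balance then excludes
  \<open>w $ j = 0\<close>.\<close>

lemma nonneg_left_null_pos:
  assumes "w v* graph_laplacian A = 0" and nonneg: "\<And>i. w $ i \<ge> 0" and "w $ u > 0"
  shows "w $ v > 0"
  using connected[of u v]
proof (induction rule: rtrancl_induct)
  case (step i j)
  have "0 < w $ i * A $ i $ j" using step by simp
  also have "\<dots> \<le> (\<Sum>i\<in>UNIV. w $ i * A $ i $ j)"
    by (rule member_le_sum) (auto simp: nonneg weight_nonneg)
  also have "\<dots> = w $ j * (\<Sum>k\<in>UNIV. A $ j $ k)"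
    using assms(1) by (simp add: graph_laplacian_left_null_iff)
  finally show ?case using nonneg[of j] by (cases "w $ j = 0") auto
qed (fact assms(3))

text \<open>A Perron-Frobenius argument. The triangle inequality gives one half of the balance
  condition for the absolute values of \<open>w\<close>; both sides have the same total over
  \<open>j\<close>, so equality holds for each \<open>j\<close>.\<close>

lemma left_null_pos:
  assumes null: "w v* graph_laplacian A = 0" and pos: "(\<Sum>i\<in>UNIV. w $ i) > 0"
  shows "w $ v > 0"
proof -
  define d where "d j = (\<Sum>k\<in>UNIV. A $ j $ k)" for j
  have d: "d j \<ge> 0" for j unfolding d_def by (intro sum_nonneg weight_nonneg)
  have w: "(\<Sum>i\<in>UNIV. w $ i * A $ i $ j) = w $ j * d j" for j
    using null by (simp add: graph_laplacian_left_null_iff d_def)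
  have le: "\<bar>w $ j\<bar> * d j \<le> (\<Sum>i\<in>UNIV. \<bar>w $ i\<bar> * A $ i $ j)" for j
    using sum_abs[of "\<lambda>i. w $ i * A $ i $ j" UNIV] d weight_nonneg
    by (simp add: w abs_mult)
  have "(\<Sum>j\<in>UNIV. (\<Sum>i\<in>UNIV. \<bar>w $ i\<bar> * A $ i $ j) - \<bar>w $ j\<bar> * d j) = 0"
    by (subst sum_subtractf, subst sum.swap) (simp add: d_def sum_distrib_left)
  with le have "(\<Sum>i\<in>UNIV. \<bar>w $ i\<bar> * A $ i $ j) - \<bar>w $ j\<bar> * d j = 0" for j
    by (subst (asm) sum_nonneg_eq_0_iff) auto
  then have null': "(\<chi> i. \<bar>w $ i\<bar> - w $ i) v* graph_laplacian A = 0"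
    using w by (simp add: graph_laplacian_left_null_iff d_def algebra_simps sum_subtractf)
  obtain u where u: "w $ u > 0"
    using pos by (metis not_le sum_nonpos)
  \<comment> \<open>A negative entry would make the nonnegative null vector of \<open>null'\<close>
    positive everywhere, but it vanishes at \<open>u\<close>.\<close>
  have nonneg: "w $ i \<ge> 0" for i
    using nonneg_left_null_pos[OF null', of i u] u by (cases "w $ i < 0") (auto simp: abs_ge_self)
  show ?thesis using nonneg_left_null_pos[OF null nonneg u] .
qed

text \<open>Induction along a path from \<open>u\<close> to \<open>v\<close>: each edge contributes
  at most the full quadratic form divided by its weight, and a square of a sum is at most twice the
  sum of squares.\<close>

lemma Poincare_inequality:
  assumes w: "\<And>i. w $ i > 0"
  obtains K :: real where "K > 0" "\<And>u v y. (y v - y u)\<^sup>2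
    \<le> K * (\<Sum>i\<in>UNIV. \<Sum>j\<in>UNIV. w $ i * A $ i $ j * (y j - y i)\<^sup>2)"
proof -
  let ?Q = "\<lambda>y. \<Sum>i\<in>UNIV. \<Sum>j\<in>UNIV. w $ i * A $ i $ j * (y j - y i)\<^sup>2"
  have term_nonneg: "0 \<le> w $ i * A $ i $ j * (y j - y i)\<^sup>2" for i j and y :: "'n \<Rightarrow> real"
    using w[of i] weight_nonneg[of i j] by simp
  have Q: "0 \<le> ?Q y" for y by (intro sum_nonneg term_nonneg)
  have "\<exists>K\<ge>0. \<forall>y. (y v - y u)\<^sup>2 \<le> K * ?Q y" for u v
    using connected[of u v]
  proof (induction rule: rtrancl_induct)
    case base
    show ?case by (rule exI[of _ 0]) simp
  next
    case (step i j)
    then obtain K where K: "K \<ge> 0" "\<And>y. (y i - y u)\<^sup>2 \<le> K * ?Q y" by blast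
    have wA: "w $ i * A $ i $ j > 0" using step w by simp
    have "(y j - y u)\<^sup>2 \<le> (2 * K + 2 / (w $ i * A $ i $ j)) * ?Q y" for y
    proof -
      have "w $ i * A $ i $ j * (y j - y i)\<^sup>2 \<le> (\<Sum>j\<in>UNIV. w $ i * A $ i $ j * (y j - y i)\<^sup>2)"
        by (rule member_le_sum) (auto intro!: term_nonneg)
      also have "\<dots> \<le> ?Q y"
        by (rule member_le_sum[where f = "\<lambda>i. \<Sum>j\<in>UNIV. w $ i * A $ i $ j * (y j - y i)\<^sup>2"])
          (auto intro!: sum_nonneg term_nonneg)
      finally have "(y j - y i)\<^sup>2 \<le> ?Q y / (w $ i * A $ i $ j)"
        using wA by (simp add: field_simps)
      moreover have "(y j - y u)\<^sup>2 \<le> 2 * (y i - y u)\<^sup>2 + 2 * (y j - y i)\<^sup>2"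
        using zero_le_power2[of "(y i - y u) - (y j - y i)"]
        by (simp add: power2_eq_square algebra_simps)
      ultimately have "(y j - y u)\<^sup>2 \<le> 2 * (K * ?Q y) + 2 * (?Q y / (w $ i * A $ i $ j))"
        using K(2)[of y] by linarith
      then show ?thesis by (simp add: algebra_simps)
    qed
    moreover have "0 \<le> 2 * K + 2 / (w $ i * A $ i $ j)" using K wA by simp
    ultimately show ?case by blast
  qed
  then have "\<forall>u v. \<exists>K. K \<ge> 0 \<and> (\<forall>y. (y v - y u)\<^sup>2 \<le> K * ?Q y)" by blast
  then obtain K where "\<forall>u v. K u v \<ge> 0 \<and> (\<forall>y. (y v - y u)\<^sup>2 \<le> K u v * ?Q y)"
    unfolding choice_iff by blast
  then have K: "\<And>u v. K u v \<ge> 0" "\<And>u v y. (y v - y u)\<^sup>2 \<le> K u v * ?Q y" by blast+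
  \<comment> \<open>The sum dominates every \<open>K u v\<close>; the \<open>+ 1\<close> makes
    \<open>M\<close> strictly positive.\<close>
  define M where "M = (\<Sum>u\<in>UNIV. \<Sum>v\<in>UNIV. K u v) + 1"
  have M: "K u v \<le> M" for u v
  proof -
    have "K u v \<le> (\<Sum>v\<in>UNIV. K u v)" by (rule member_le_sum) (auto simp: K)
    also have "\<dots> \<le> (\<Sum>u\<in>UNIV. \<Sum>v\<in>UNIV. K u v)"
      by (rule member_le_sum[where f = "\<lambda>u. \<Sum>v\<in>UNIV. K u v"]) (auto intro!: sum_nonneg K)
    finally show ?thesis by (simp add: M_def)
  qed
  show thesis
  proof (rule that)
    show "M > 0" unfolding M_def by (intro add_nonneg_pos sum_nonneg K) auto
    show "(y v - y u)\<^sup>2 \<le> M * ?Q y" for u v y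
      using K(2)[of y v u] mult_right_mono[OF M[of u v] Q[of y]] by linarith
  qed
qed

end

subsection \<open>Trajectories\<close>

locale consensus_protocol = irreducible_weights A for A :: "real ^ 'n ^ 'n::finite" +
  fixes h :: "real \<Rightarrow> real" and x :: "real \<Rightarrow> real ^ 'n"
  assumes mono_h: "mono h"
    and deriv: "t \<ge> 0 \<Longrightarrow> ((\<lambda>s. x s $ i) has_real_derivative
      (\<Sum>j\<in>UNIV. A $ i $ j * (h (x t $ j) - h (x t $ i)))) (at t within {0..})"
begin

lemma continuous_on_state: "continuous_on {0..} (\<lambda>s. x s $ i)"
  unfolding continuous_on_eq_continuous_within using deriv by (blast intro: DERIV_continuous)

text \<open>Maximum principle: a coordinate that is maximal at time \<open>r\<close> supports the
  maximum \<open>F\<close> from below, and all differences in its drift are nonpositive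
  there.\<close>

lemma state_le:
  assumes "0 \<le> s" "s \<le> t" and le: "\<And>i. x s $ i \<le> M"
  shows "x t $ i \<le> M"
proof -
  define F where "F r = Max (range (\<lambda>i. x r $ i))" for r
  have "F t - F s \<le> 0 * (t - s)"
  proof (rule growth_le_of_left_support)
    have "continuous_on {s..t} (\<lambda>r. x r $ i)" for i
      using continuous_on_state by (rule continuous_on_subset) (use assms in auto)
    then show "continuous_on {s..t} F"
      unfolding F_def by (intro continuous_on_Max_image) auto
  next
    fix r assume r: "s < r" "r \<le> t"
    have "F r \<in> range (\<lambda>i. x r $ i)" unfolding F_def by (intro Max_in) auto
    then obtain i where i: "F r = x r $ i" by auto
    have "x r $ j \<le> x r $ i" for j unfolding i[symmetric] F_def by (intro Max_ge) auto
    then have "(\<Sum>j\<in>UNIV. A $ i $ j * (h (x r $ j) - h (x r $ i))) \<le> 0"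
      using monoD[OF mono_h]
      by (intro sum_nonpos mult_nonneg_nonpos weight_nonneg) simp
    moreover have "((\<lambda>s. x s $ i) has_real_derivative
        (\<Sum>j\<in>UNIV. A $ i $ j * (h (x r $ j) - h (x r $ i)))) (at r within {s..t})"
      by (rule has_field_derivative_subset[OF deriv]) (use r assms in auto)
    moreover have "\<forall>q\<in>{s..r}. x q $ i \<le> F q" unfolding F_def by auto
    ultimately show "\<exists>u D. (u has_real_derivative D) (at r within {s..t}) \<and> D \<le> 0 \<and>
        u r = F r \<and> (\<forall>q\<in>{s..r}. u q \<le> F q)"
      using i by fastforce
  qed fact
  moreover have "x t $ i \<le> F t" unfolding F_def by auto
  moreover have "F s \<le> M" unfolding F_def using le by auto
  ultimately show ?thesis by linarith
qed

text \<open>The reflected trajectory \<open>- x\<close> follows the same protocol with the monotone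
  function \<open>- h (- z)\<close>, so the upper bound transfers.\<close>

lemma state_ge:
  assumes "0 \<le> s" "s \<le> t" and ge: "\<And>i. M \<le> x s $ i"
  shows "M \<le> x t $ i"
proof -
  interpret reflected: consensus_protocol A "\<lambda>z. - h (- z)" "\<lambda>s. - x s"
  proof
    fix t :: real and i assume "t \<ge> 0"
    from DERIV_minus[OF deriv[OF this, of i]]
    show "((\<lambda>s. (- x s) $ i) has_real_derivative
        (\<Sum>j\<in>UNIV. A $ i $ j * (- h (- (- x t) $ j) - - h (- (- x t) $ i)))) (at t within {0..})"
      by (simp add: sum_negf[symmetric] right_diff_distrib)
  qed (use mono_h in \<open>auto simp: mono_def\<close>)
  show ?thesis using reflected.state_le[of s t "- M" i] assms by simp
qed

section \<open>Conserved mean, energy dissipation and convergence\<close>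

context
  fixes w :: "real ^ 'n"
  assumes null: "w v* graph_laplacian A = 0" and sum_1: "(\<Sum>i\<in>UNIV. w $ i) = 1"
begin

lemma weight_pos: "w $ i > 0"
  by (rule left_null_pos) (simp_all add: null sum_1)

lemma mean_conserved:
  assumes "t \<ge> 0"
  shows "(\<Sum>i\<in>UNIV. w $ i * x t $ i) = (\<Sum>i\<in>UNIV. w $ i * x 0 $ i)"
proof -
  have "((\<lambda>s. \<Sum>i\<in>UNIV. w $ i * x s $ i) has_real_derivative 0) (at s within {0..})"
    if "s \<in> {0..}" for s
  proof -
    have "((\<lambda>s. \<Sum>i\<in>UNIV. w $ i * x s $ i) has_real_derivative
        (\<Sum>i\<in>UNIV. w $ i * (\<Sum>j\<in>UNIV. A $ i $ j * (h (x s $ j) - h (x s $ i)))))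
        (at s within {0..})"
      using that by (intro DERIV_sum DERIV_cmult deriv) auto
    then show ?thesis by (simp only: graph_laplacian_conserved[OF null])
  qed
  then have "\<exists>c. \<forall>s\<in>{0..}. (\<Sum>i\<in>UNIV. w $ i * x s $ i) = c"
    by (intro has_field_derivative_zero_constant) auto
  then show ?thesis using assms by fastforce
qed

text \<open>A spread of at least \<open>\<epsilon>\<close> at all times would make \<open>V\<close>
  decrease at a fixed rate forever, against its lower bound.\<close>

lemma spread_becomes_small:
  assumes strict: "strict_mono h" and "\<epsilon> > 0"
  shows "\<exists>T\<ge>0. \<forall>i j. x T $ j - x T $ i < \<epsilon>"
proof (rule ccontr)
  assume "\<not> (\<exists>T\<ge>0. \<forall>i j. x T $ j - x T $ i < \<epsilon>)"
  then have "\<exists>i j. \<not> x t $ j - x t $ i < \<epsilon>" if "t \<ge> 0" for t using that by blast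
  then have spread: "\<exists>i j. x t $ i + \<epsilon> \<le> x t $ j" if "t \<ge> 0" for t
    using that by (simp add: not_less le_diff_eq add.commute)
  let ?Q = "\<lambda>y. \<Sum>i\<in>UNIV. \<Sum>j\<in>UNIV. w $ i * A $ i $ j * (y j - y i)\<^sup>2"
  obtain K where K: "K > 0" "\<And>u v y. (y v - y u)\<^sup>2 \<le> K * ?Q y"
    using Poincare_inequality[of w, OF weight_pos] by blast
  define p where "p = Min (range (\<lambda>i. x 0 $ i))"
  define q where "q = Max (range (\<lambda>i. x 0 $ i))"
  have range: "p \<le> x t $ i" "x t $ i \<le> q" if "t \<ge> 0" for t i
    using state_ge[of 0 t p i] state_le[of 0 t q i] that by (auto simp: p_def q_def)
  obtain c where c: "c > 0"
      "\<And>a b. p \<le> a \<Longrightarrow> a \<le> q \<Longrightarrow> a + \<epsilon> \<le> b \<Longrightarrow> c \<le> h b - h a"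
    using strict_mono_uniform_increase[OF strict \<open>\<epsilon> > 0\<close>, of p q] by blast
  \<comment> \<open>The dissipation is half of \<open>?Q\<close>, and \<open>?Q\<close> is at least
    \<open>c\<^sup>2 / K\<close>.\<close>
  define r where "r = c\<^sup>2 / K / 2"
  have "r > 0" using c K by (simp add: r_def)
  have dissipation: "(\<Sum>i\<in>UNIV. w $ i * h (x t $ i) *
      (\<Sum>j\<in>UNIV. A $ i $ j * (h (x t $ j) - h (x t $ i)))) \<le> - r" if t: "t \<ge> 0" for t
  proof -
    obtain i j where "x t $ i + \<epsilon> \<le> x t $ j" using spread[OF t] by blast
    with c range[OF t] have "c \<le> h (x t $ j) - h (x t $ i)" by blast
    then have "c\<^sup>2 \<le> (h (x t $ j) - h (x t $ i))\<^sup>2" using c(1) by (intro power_mono) auto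
    also have "\<dots> \<le> K * ?Q (\<lambda>i. h (x t $ i))" by (rule K)
    finally show ?thesis
      unfolding graph_laplacian_energy[OF null, of "\<lambda>i. h (x t $ i)"]
      using K(1) by (simp add: r_def field_simps)
  qed
  obtain H where H: "\<And>a b. h a * (b - a) \<le> H b - H a"
    using mono_is_subgradient[OF mono_h] by blast
  have cont_H: "continuous_on UNIV H"
    using convex_on_continuous[OF open_UNIV convex_on_if_subgradient[of h H]] H by blast
  define V where "V t = (\<Sum>i\<in>UNIV. w $ i * H (x t $ i))" for t
  have decay: "V t - V 0 \<le> - r * (t - 0)" if "t \<ge> 0" for t
  proof (rule growth_le_of_left_support)
    have "continuous_on {0..t} (\<lambda>s. x s $ i)" for i
      using continuous_on_state by (rule continuous_on_subset) auto
    then show "continuous_on {0..t} V"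
      unfolding V_def
      by (intro continuous_on_sum continuous_on_mult continuous_on_const
          continuous_on_compose2[OF cont_H]) auto
  next
    fix s assume s: "0 < s" "s \<le> t"
    \<comment> \<open>\<open>H\<close> is replaced by its supporting line at the state at time
      \<open>s\<close>. Unlike \<open>V\<close>, the result is certainly differentiable in time, and
      it stays below \<open>V\<close>.\<close>
    define u where "u \<tau> =
      (\<Sum>i\<in>UNIV. w $ i * (H (x s $ i) + h (x s $ i) * (x \<tau> $ i - x s $ i)))" for \<tau>
    define D where "D = (\<Sum>i\<in>UNIV. w $ i * h (x s $ i) *
      (\<Sum>j\<in>UNIV. A $ i $ j * (h (x s $ j) - h (x s $ i))))"
    have "((\<lambda>s. x s $ i) has_real_derivative
        (\<Sum>j\<in>UNIV. A $ i $ j * (h (x s $ j) - h (x s $ i)))) (at s within {0..t})" for i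
      by (rule has_field_derivative_subset[OF deriv]) (use s in auto)
    then have "(u has_real_derivative D) (at s within {0..t})"
      unfolding u_def D_def by (auto intro!: derivative_eq_intros sum.cong simp: mult.assoc)
    moreover have "D \<le> - r" unfolding D_def using s by (intro dissipation) simp
    moreover have "u s = V s" by (simp add: u_def V_def)
    moreover have "u \<tau> \<le> V \<tau>" for \<tau>
      unfolding u_def V_def
    proof (intro sum_mono mult_left_mono)
      show "H (x s $ i) + h (x s $ i) * (x \<tau> $ i - x s $ i) \<le> H (x \<tau> $ i)" for i
        using H[of "x s $ i" "x \<tau> $ i"] by simp
    qed (simp add: weight_pos less_imp_le)
    ultimately show "\<exists>u D. (u has_real_derivative D) (at s within {0..t}) \<and> D \<le> - r \<and>
        u s = V s \<and> (\<forall>\<tau>\<in>{0..s}. u \<tau> \<le> V \<tau>)" by blast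
  qed fact
  \<comment> \<open>The supporting line of \<open>H\<close> at \<open>0\<close>, evaluated at the
    conserved mean, bounds \<open>V\<close> at every time (Jensen).\<close>
  define B where "B = H 0 + h 0 * (\<Sum>i\<in>UNIV. w $ i * x 0 $ i)"
  have bound: "B \<le> V t" if "t \<ge> 0" for t
  proof -
    have "B = (\<Sum>i\<in>UNIV. w $ i * (H 0 + h 0 * x t $ i))"
      unfolding B_def mean_conserved[OF that, symmetric]
      by (simp add: distrib_left sum.distrib sum_distrib_right[symmetric] sum_1 sum_distrib_left
          mult.left_commute)
    also have "\<dots> \<le> V t"
      unfolding V_def
    proof (intro sum_mono mult_left_mono)
      show "H 0 + h 0 * x t $ i \<le> H (x t $ i)" for i
        using H[of 0 "x t $ i"] by simp
    qed (simp add: weight_pos less_imp_le)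
    finally show ?thesis .
  qed
  \<comment> \<open>By this time the decay would have brought \<open>V\<close> down to
    \<open>B - 1\<close>.\<close>
  define t where "t = (V 0 - B + 1) / r"
  have "t \<ge> 0" using bound[of 0] \<open>r > 0\<close> by (simp add: t_def)
  moreover have "r * t = V 0 - B + 1" using \<open>r > 0\<close> by (simp add: t_def)
  ultimately show False using decay[of t] bound[of t] by simp
qed

lemma weighted_mean_mem:
  assumes "\<And>i. a \<le> y i" "\<And>i. y i \<le> b"
  shows "(\<Sum>i\<in>UNIV. w $ i * y i) \<in> {a..b}"
proof -
  have "(\<Sum>i\<in>UNIV. w $ i * a) \<le> (\<Sum>i\<in>UNIV. w $ i * y i)"
    "(\<Sum>i\<in>UNIV. w $ i * y i) \<le> (\<Sum>i\<in>UNIV. w $ i * b)"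
    using assms by (auto intro!: sum_mono mult_left_mono simp: weight_pos less_imp_le)
  then show ?thesis by (simp add: sum_distrib_right[symmetric] sum_1)
qed

text \<open>Once the spread is below \<open>\<epsilon>\<close>, the interval spanned by the states
  at that time contains all later states and also the conserved mean.\<close>

theorem consensus:
  assumes "strict_mono h"
  shows "((\<lambda>t. x t $ i) \<longlongrightarrow> (\<Sum>k\<in>UNIV. w $ k * x 0 $ k)) at_top"
proof (rule tendstoI)
  fix \<epsilon> :: real assume "\<epsilon> > 0"
  then obtain T where T: "T \<ge> 0" "\<And>i j. x T $ j - x T $ i < \<epsilon>"
    using spread_becomes_small assms by blast
  define p where "p = Min (range (\<lambda>i. x T $ i))"
  define q where "q = Max (range (\<lambda>i. x T $ i))"
  have pq: "p \<le> x T $ i" "x T $ i \<le> q" for i by (auto simp: p_def q_def)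
  have "p \<in> range (\<lambda>i. x T $ i)" "q \<in> range (\<lambda>i. x T $ i)"
    unfolding p_def q_def by (intro Min_in Max_in; simp)+
  then have "q - p < \<epsilon>" using T(2) by auto
  moreover have "(\<Sum>k\<in>UNIV. w $ k * x 0 $ k) \<in> {p..q}"
    using weighted_mean_mem[of p "\<lambda>k. x T $ k" q] pq mean_conserved[OF T(1)] by simp
  moreover have "x t $ i \<in> {p..q}" if "t \<ge> T" for t
    using state_ge[OF T(1) that] state_le[OF T(1) that] pq by auto
  ultimately have "dist (x t $ i) (\<Sum>k\<in>UNIV. w $ k * x 0 $ k) < \<epsilon>" if "t \<ge> T" for t
    using that by (fastforce simp: dist_real_def abs_less_iff)
  then show "\<forall>\<^sub>F t in at_top. dist (x t $ i) (\<Sum>k\<in>UNIV. w $ k * x 0 $ k) < \<epsilon>"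
    using eventually_ge_at_top[of T] by (rule eventually_mono[rotated])
qed

end

end

theorem theorem1:
  fixes G :: "'n::finite pair_pre_digraph"
    and A :: "real ^ 'n ^ 'n"
    and \<xi> :: "real ^ 'n"
    and h :: "real \<Rightarrow> real"
    and x :: "real \<Rightarrow> real ^ 'n"
  assumes "weighted_digraph G A"
    and "strongly_connected (with_proj G)"
    and "\<xi> v* graph_laplacian A = 0"
    and "(\<Sum>i\<in>UNIV. \<xi> $ i) = 1"
    and "strict_mono h"
    and "protocol_solution (graph_laplacian A) h x"
  shows "\<forall>i. ((\<lambda>t. x t $ i) \<longlongrightarrow> (\<Sum>k\<in>UNIV. \<xi> $ k * x 0 $ k)) at_top"
proof -
  interpret weighted_digraph G A by fact
  interpret consensus_protocol A h x
  proof
    show "0 \<le> A $ i $ j" for i j by (rule weight_nonneg)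
    \<comment> \<open>Arcs are exactly the positive weights, so reachability in the digraph is the
      closure demanded by the locale.\<close>
    have "{(i, j). A $ i $ j > 0} = parcs G" by (auto simp: weight_pos_iff)
    then show "(i, j) \<in> {(i, j). A $ i $ j > 0}\<^sup>*" for i j
      using assms(2) reachable_rtranclI[of "with_proj G" i j]
      by (auto simp: strongly_connected_def verts_UNIV)
    show "mono h" using assms(5) by (rule strict_mono_mono)
    show "((\<lambda>s. x s $ i) has_real_derivative
        (\<Sum>j\<in>UNIV. A $ i $ j * (h (x t $ j) - h (x t $ i)))) (at t within {0..})"
      if "t \<ge> 0" for t i
    proof -
      have "- (\<Sum>j\<in>UNIV. graph_laplacian A $ i $ j * h (x t $ j))
          = (\<Sum>j\<in>UNIV. A $ i $ j * (h (x t $ j) - h (x t $ i)))"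
        unfolding graph_laplacian_apply[where y = "\<lambda>j. h (x t $ j)"]
        by (simp add: sum_negf[symmetric] right_diff_distrib)
      then show ?thesis using assms(6) that unfolding protocol_solution_def by metis
    qed
  qed
  show ?thesis using consensus assms(3-5) by blast
qed

end
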